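(* For every $K\in\mathbb{R}^{2}$ (regarded as a $1\times 2$ gain), there exist $T\geq\mu>0$ such that $K$ is not a $(T,\mu)$-stabilizer for the double integrator $\dot x_1=x_2,\ \dot x_2=\alpha u$.
   Context: For positive constants $\mu\leq T$, a $(T,\mu)$-signal is a measurable function $\alpha:\mathbb{R}_{\geq 0}\to[0,1]$ such that $\int_t^{t+T}\alpha(s)\,ds\geq\mu$ for every $t\geq 0$; $\mathcal{G}(T,\mu)$ denotes the set of all $(T,\mu)$-signals. The double integrator is the system $\dot x=Ax+\alpha(t)Bu$ with $x=(x_1,x_2)^\top\in\mathbb{R}^2$, $u\in\mathbb{R}$, $A=\begin{pmatrix}0&1\\0&0\end{pmatrix}$, $B=\begin{pmatrix}0\\1\end{pmatrix}$. For a row vector $K\in\mathbb{R}^{1\times 2}$, $t_0\ge0$ and $x_0\in\mathbb{R}^2$, $x(\cdot\,;t_0,x_0,K,\alpha)$ denotes the solution of $\dot x=(A+\alpha(t)BK)x$ with $x(t_0)=x_0$. A function $\beta:\mathbb{R}_{\geq 0}\times\mathbb{R}_{\geq 0}\to\mathbb{R}_{\geq 0}$ is of class $\mathcal{KL}$ if $\beta(\cdot,t)$ is continuous, strictly increasing and vanishes at $0$ for every $t\ge0$, and $\beta(s,\cdot)$ is continuous, non-increasing and tends to zero at infinity for every $s\ge 0$. The gain $K$ is a $(T,\mu)$-stabilizer if there exists a class $\mathcal{KL}$ function $\beta$ such that, for every $\alpha\in\mathcal{G}(T,\mu)$, $x_0\in\mathbb{R}^2$ and $t_0\geq 0$, one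 has $|x(t;t_0,x_0,K,\alpha)|\leq\beta(|x_0|,t-t_0)$ for all $t\geq t_0$, where $|\cdot|$ is the Euclidean norm. *)

theory Defs
  imports "HOL-Analysis.Analysis"
begin

text \<open>
  Functions on the nonnegative reals are represented by functions on \<^typ>\<open>real\<close>; all
  conditions are imposed on nonnegative arguments only. Measurability is Lebesgue measurability.
\<close>

definition pe_signals :: "real \<Rightarrow> real \<Rightarrow> (real \<Rightarrow> real) set" where
  "pe_signals T \<mu> =
     {\<alpha>. \<alpha> \<in> borel_measurable (lebesgue_on {0..}) \<and>
          (\<forall>t\<ge>0. \<alpha> t \<in> {0..1}) \<and>
          (\<forall>t\<ge>0. integral {t..t + T} \<alpha> \<ge> \<mu>)}"

definition class_KL :: "(real \<Rightarrow> real \<Rightarrow> real) \<Rightarrow> bool" where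
  "class_KL \<beta> \<longleftrightarrow>
     (\<forall>s\<ge>0. \<forall>t\<ge>0. \<beta> s t \<ge> 0) \<and>
     (\<forall>t\<ge>0. continuous_on {0..} (\<lambda>s. \<beta> s t) \<and>
            strict_mono_on {0..} (\<lambda>s. \<beta> s t) \<and> \<beta> 0 t = 0) \<and>
     (\<forall>s\<ge>0. continuous_on {0..} (\<beta> s) \<and>
            antimono_on {0..} (\<beta> s) \<and> (\<beta> s \<longlongrightarrow> 0) at_top)"

definition dint_A :: "real^2^2" where
  "dint_A = vector [vector [0, 1], vector [0, 0]]"

definition dint_B :: "real^1^2" where
  "dint_B = vector [vector [0], vector [1]]"

text \<open>
  Since \<open>\<alpha>\<close> is merely measurable, solutions are understood in the sense of Caratheodory,
  expressed by the integral form of the equation. For a measurable signal with values in the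
  unit interval the solution through any initial condition exists and is unique on
  \<open>{t0..}\<close>, so quantifying over all solutions is the same as speaking about the solution.
\<close>

definition is_closed_loop_solution ::
    "real^2^1 \<Rightarrow> (real \<Rightarrow> real) \<Rightarrow> real \<Rightarrow> real^2 \<Rightarrow> (real \<Rightarrow> real^2) \<Rightarrow> bool" where
  "is_closed_loop_solution K \<alpha> t0 x0 x \<longleftrightarrow>
     (\<forall>t\<ge>t0.
        (\<lambda>s. (dint_A + \<alpha> s *\<^sub>R (dint_B ** K)) *v x s) absolutely_integrable_on {t0..t} \<and>
        x t = x0 + integral {t0..t} (\<lambda>s. (dint_A + \<alpha> s *\<^sub>R (dint_B ** K)) *v x s))"

definition stabilizer :: "real \<Rightarrow> real \<Rightarrow> real^2^1 \<Rightarrow> bool" where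
  "stabilizer T \<mu> K \<longleftrightarrow>
     (\<exists>\<beta>. class_KL \<beta> \<and>
        (\<forall>\<alpha> \<in> pe_signals T \<mu>. \<forall>x0. \<forall>t0\<ge>0. \<forall>x.
           is_closed_loop_solution K \<alpha> t0 x0 x \<longrightarrow>
           (\<forall>t\<ge>t0. norm (x t) \<le> \<beta> (norm x0) (t - t0))))"

end

theory Submission
  imports Defs
begin

text \<open>
  If \<open>K $ 1 $ 1 \<ge> 0\<close>, then the constant signal \<open>1\<close> leaves the closed loop with a real eigenvalue
  \<open>\<ge> 0\<close>. If \<open>K $ 1 $ 1 < 0\<close>, one prescribes the trajectory and reads the signal off it. Start at
  position \<open>L\<close>, with \<open>L\<close> large, and velocity \<open>1\<close>, and impose the acceleration \<open>-3\<close> for one time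
  unit; since \<open>L\<close> is large, a signal with values in \<open>(0,1]\<close> produces it. Then switch the
  signal off: the velocity stays at \<open>-2\<close>, and the position drifts down to \<open>-2 L\<close>. The state has
  been multiplied by \<open>-2\<close>, and by linearity the same signal can be repeated periodically.
\<close>

section \<open>The closed loop\<close>

text \<open>As a linear combination of fixed vectors, a curve in the plane is within reach of the
  continuity and derivative rules.\<close>

lemma vector_2_eq_axis: "(vector [a, b] :: real^2) = a *\<^sub>R axis 1 1 + b *\<^sub>R axis 2 1"
  by (simp add: vec_eq_iff forall_2 axis_def)

lemma closed_loop_field:
  "(dint_A + a *\<^sub>R (dint_B ** K)) *v y =
     vector [y $ 2, a * (K $ 1 $ 1 * y $ 1 + K $ 1 $ 2 * y $ 2)]"
  by (simp add: vec_eq_iff forall_2 dint_A_def dint_B_def matrix_vector_mult_def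
      matrix_matrix_mult_def sum_2 algebra_simps)

text \<open>The integral identity alone suffices. It makes \<open>x\<close> an indefinite integral,
  hence continuous; as the signal lies in the unit interval, the continuous function
  \<open>?g\<close> dominates the field, and absolute integrability follows.\<close>

lemma is_closed_loop_solutionI:
  assumes \<alpha>: "\<And>t. 0 \<le> t \<Longrightarrow> \<alpha> t \<in> {0..1}"
    and x: "\<And>t. 0 \<le> t \<Longrightarrow>
      ((\<lambda>s. (dint_A + \<alpha> s *\<^sub>R (dint_B ** K)) *v x s) has_integral (x t - x 0)) {0..t}"
  shows "is_closed_loop_solution K \<alpha> 0 (x 0) x"
  unfolding is_closed_loop_solution_def
proof (intro allI impI conjI)
  fix t :: real assume t: "0 \<le> t"
  let ?f = "\<lambda>s. (dint_A + \<alpha> s *\<^sub>R (dint_B ** K)) *v x s"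
  let ?g = "\<lambda>s. norm (dint_A *v x s) + norm ((dint_B ** K) *v x s)"
  have eq: "x s = x 0 + integral {0..s} ?f" if "0 \<le> s" for s
    using integral_unique[OF x[OF that]] by simp
  then show "x t = x 0 + integral {0..t} ?f"
    using t .
  have "continuous_on {0..t} (\<lambda>s. x 0 + integral {0..s} ?f)"
    using x[OF t] by (intro continuous_intros indefinite_integral_continuous_1) blast
  then have "continuous_on {0..t} x"
    by (rule continuous_on_eq) (simp only: eq[symmetric] atLeastAtMost_iff)
  then have "continuous_on {0..t} ?g"
    by (intro continuous_intros bounded_linear.continuous_on[OF matrix_vector_mul_bounded_linear])
  then have g: "?g integrable_on {0..t}"
    by (rule integrable_continuous_interval)
  have "norm (?f s) \<le> ?g s" if "s \<in> {0..t}" for s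
  proof -
    have "?f s = dint_A *v x s + \<alpha> s *\<^sub>R ((dint_B ** K) *v x s)"
      by (simp add: matrix_vector_mult_add_rdistrib scaleR_matrix_vector_assoc)
    also have "norm \<dots> \<le> norm (dint_A *v x s) + \<bar>\<alpha> s\<bar> * norm ((dint_B ** K) *v x s)"
      by (metis norm_scaleR norm_triangle_ineq)
    also have "\<dots> \<le> ?g s"
      using \<alpha>[of s] that by (auto intro: mult_left_le_one_le)
    finally show ?thesis .
  qed
  then show "?f absolutely_integrable_on {0..t}"
    using x[OF t] g by (intro absolutely_integrable_integrable_bound[where g = ?g]) blast+
qed

text \<open>For a fixed initial state a class KL bound tends to 0 in time, so a solution that has
  norm at least \<open>r\<close> at arbitrarily late times violates it.\<close>

lemma not_stabilizerI:
  assumes "\<alpha> \<in> pe_signals T \<mu>" "is_closed_loop_solution K \<alpha> 0 x0 x"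
    and "0 < r" and "\<And>N. \<exists>t\<ge>N. r \<le> norm (x t)"
  shows "\<not> stabilizer T \<mu> K"
proof
  assume "stabilizer T \<mu> K"
  then obtain \<beta> where \<beta>: "class_KL \<beta>" "\<And>t. 0 \<le> t \<Longrightarrow> norm (x t) \<le> \<beta> (norm x0) t"
    using assms(1,2) unfolding stabilizer_def by fastforce
  have "(\<beta> (norm x0) \<longlongrightarrow> 0) at_top"
    using \<beta>(1) unfolding class_KL_def by auto
  then have "\<forall>\<^sub>F t in at_top. \<beta> (norm x0) t < r"
    using \<open>0 < r\<close> by (rule order_tendstoD)
  then obtain N where N: "\<And>t. N \<le> t \<Longrightarrow> \<beta> (norm x0) t < r"
    by (auto simp: eventually_at_top_linorder)
  obtain t where "max 0 N \<le> t" "r \<le> norm (x t)"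
    using assms(4) by blast
  then show False
    using N[of t] \<beta>(2)[of t] by simp
qed

section \<open>Nonnegative position gain: a nondecaying exponential solution\<close>

lemma not_stabilizer_of_nonneg:
  fixes K :: "real^2^1"
  assumes "0 \<le> K $ 1 $ 1"
  shows "\<not> stabilizer 1 1 K"
proof -
  define k l where "k = K $ 1 $ 1" and "l = K $ 1 $ 2"
  \<comment> \<open>The larger root of \<rho>^2 = l \<rho> + k, the characteristic equation of the
    loop with signal 1. It is nonnegative because k \<ge> 0, and (1, \<rho>) is an eigenvector for
    it.\<close>
  define \<rho> where "\<rho> = (l + sqrt (l\<^sup>2 + 4 * k)) / 2"
  have k: "0 \<le> k"
    using assms by (simp add: k_def)
  have "\<bar>l\<bar> \<le> sqrt (l\<^sup>2 + 4 * k)"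
    unfolding real_sqrt_abs[symmetric] using k by (intro real_sqrt_le_mono) simp
  then have \<rho>0: "0 \<le> \<rho>"
    by (simp add: \<rho>_def)
  have \<rho>: "\<rho> * \<rho> = k + l * \<rho>"
  proof -
    have "2 * \<rho> - l = sqrt (l\<^sup>2 + 4 * k)"
      by (simp add: \<rho>_def add_divide_distrib)
    then have "(2 * \<rho> - l)\<^sup>2 = l\<^sup>2 + 4 * k"
      using k by simp
    then show ?thesis
      by algebra
  qed
  define x :: "real \<Rightarrow> real^2" where "x t = exp (\<rho> * t) *\<^sub>R vector [1, \<rho>]" for t
  have sol: "is_closed_loop_solution K (\<lambda>_. 1) 0 (x 0) x"
  proof (rule is_closed_loop_solutionI)
    fix t :: real assume t: "0 \<le> t"
    have "(x has_vector_derivative (dint_A + 1 *\<^sub>R (dint_B ** K)) *v x s) (at s within {0..t})" for s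
    proof -
      have "(x has_vector_derivative (exp (\<rho> * s) * \<rho>) *\<^sub>R vector [1, \<rho>]) (at s within {0..t})"
        unfolding x_def by (auto intro!: derivative_eq_intros)
      also have "(exp (\<rho> * s) * \<rho>) *\<^sub>R vector [1, \<rho>] = (dint_A + 1 *\<^sub>R (dint_B ** K)) *v x s"
      proof -
        have "exp (\<rho> * s) * \<rho> * \<rho> = k * exp (\<rho> * s) + l * (exp (\<rho> * s) * \<rho>)"
          unfolding mult.assoc \<rho> by (simp add: distrib_left mult_ac)
        then show ?thesis
          unfolding closed_loop_field
          by (simp add: x_def vec_eq_iff forall_2 flip: k_def l_def)
      qed
      finally show ?thesis .
    qed
    then show "((\<lambda>s. (dint_A + 1 *\<^sub>R (dint_B ** K)) *v x s) has_integral (x t - x 0)) {0..t}"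
      using t by (intro fundamental_theorem_of_calculus) auto
  qed simp
  have "1 \<le> norm (x t)" if "0 \<le> t" for t
  proof -
    have "1 \<le> x t $ 1"
      using \<rho>0 that by (simp add: x_def)
    then show ?thesis
      using component_le_norm_cart[of "x t" 1] by linarith
  qed
  then have "\<exists>t\<ge>N. 1 \<le> norm (x t)" for N
    by (intro exI[of _ "max 0 N"]) simp
  moreover have "(\<lambda>_. 1) \<in> pe_signals 1 1"
    by (simp add: pe_signals_def)
  ultimately show ?thesis
    using sol by (intro not_stabilizerI[where r = 1]) auto
qed

section \<open>Self-similar extension of a function from one period\<close>

text \<open>The factor \<open>c = 1\<close> gives the periodic extension, used for the signal;
  \<open>c = -2\<close> serves the state and its vector field.\<close>

definition self_similar :: "real \<Rightarrow> real \<Rightarrow> (real \<Rightarrow> 'a) \<Rightarrow> real \<Rightarrow> 'a::real_vector" where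
  "self_similar P c g t = c ^ nat \<lfloor>t / P\<rfloor> *\<^sub>R g (t - P * of_int \<lfloor>t / P\<rfloor>)"

lemma self_similar_eq:
  assumes "0 < P" "P * real n \<le> t" "t < P * real n + P"
  shows "self_similar P c g t = c ^ n *\<^sub>R g (t - P * real n)"
proof -
  have "\<lfloor>t / P\<rfloor> = int n"
    using assms by (intro floor_unique) (auto simp: field_simps)
  then show ?thesis
    by (simp add: self_similar_def)
qed

lemma self_similar_cases:
  assumes "0 < P" "0 \<le> (t::real)"
  obtains n where "P * real n \<le> t" "t < P * real n + P"
proof
  have "0 \<le> \<lfloor>t / P\<rfloor>"
    using assms by simp
  then have *: "real (nat \<lfloor>t / P\<rfloor>) = of_int \<lfloor>t / P\<rfloor>"
    by simp
  show "P * real (nat \<lfloor>t / P\<rfloor>) \<le> t" "t < P * real (nat \<lfloor>t / P\<rfloor>) + P"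
    using assms floor_divide_lower[of P t] floor_divide_upper[of P t] *
    by (simp_all add: algebra_simps)
qed

text \<open>The condition \<open>per\<close> makes the pieces of the extended \<open>q\<close> fit
  together at multiples of \<open>P\<close>: the integral over period number n is c^n (q P - q 0) =
  c^(n+1) q 0 - c^n q 0, and these increments telescope.\<close>

lemma has_integral_self_similar:
  fixes q f :: "real \<Rightarrow> 'a::banach"
  assumes P: "0 < P" and per: "q P = c *\<^sub>R q 0"
    and f: "\<And>\<theta>. \<lbrakk>0 \<le> \<theta>; \<theta> \<le> P\<rbrakk> \<Longrightarrow> (f has_integral (q \<theta> - q 0)) {0..\<theta>}"
    and t: "0 \<le> t"
  shows "(self_similar P c f has_integral (self_similar P c q t - self_similar P c q 0)) {0..t}"
proof -
  let ?F = "self_similar P c f"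
  have piece: "(?F has_integral (c ^ n *\<^sub>R (q (t - P * real n) - q 0))) {P * real n..t}"
    if "P * real n \<le> t" "t \<le> P * real n + P" for n t
  proof -
    have "(f has_integral (q (t - P * real n) - q 0)) {0..t - P * real n}"
      using that by (intro f) (auto simp: field_simps)
    from has_integral_shift_real_ivl[OF this, of "- (P * real n)"]
    have "((\<lambda>s. f (s - P * real n)) has_integral (q (t - P * real n) - q 0)) {P * real n..t}"
      by simp
    from has_integral_cmul[OF this, of "c ^ n"]
    \<comment> \<open>At the right endpoint the extension already takes its value from the next
      period; this single point does not affect the integral.\<close>
    show ?thesis
      by (rule has_integral_spike_finite[rotated 2, where S = "{P * real n + P}"])
        (use that P in \<open>auto intro!: self_similar_eq\<close>)
  qed
  have grid: "(?F has_integral (c ^ n *\<^sub>R q 0 - q 0)) {0..P * real n}" for n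
  proof (induction n)
    case (Suc n)
    have "(?F has_integral (c ^ n *\<^sub>R (q P - q 0))) {P * real n..P * real n + P}"
      using piece[of n "P * real n + P"] P by simp
    from has_integral_combine[OF _ _ Suc.IH this] P
    have "(?F has_integral (c ^ n *\<^sub>R q 0 - q 0 + c ^ n *\<^sub>R (q P - q 0))) {0..P * real n + P}"
      by simp
    moreover have "c ^ n *\<^sub>R q 0 - q 0 + c ^ n *\<^sub>R (q P - q 0) = c ^ Suc n *\<^sub>R q 0 - q 0"
      by (simp add: per scaleR_diff_right mult.commute)
    moreover have "P * real n + P = P * real (Suc n)"
      by (simp add: distrib_left)
    ultimately show ?case
      by simp
  qed (simp add: has_integral_refl)
  obtain n where n: "P * real n \<le> t" "t < P * real n + P"
    using self_similar_cases[OF P t] .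
  have "(?F has_integral (c ^ n *\<^sub>R q 0 - q 0 + c ^ n *\<^sub>R (q (t - P * real n) - q 0))) {0..t}"
    by (rule has_integral_combine[OF _ n(1) grid piece]) (use n P in simp_all)
  moreover have "self_similar P c q 0 = q 0"
    using self_similar_eq[of P 0 0 c q] P by simp
  moreover have "self_similar P c q t = c ^ n *\<^sub>R q (t - P * real n)"
    by (rule self_similar_eq[OF P n])
  ultimately show ?thesis
    by (simp add: scaleR_diff_right)
qed

section \<open>Negative position gain\<close>

lemma not_stabilizer_of_neg:
  fixes K :: "real^2^1"
  assumes "K $ 1 $ 1 < 0"
  shows "\<exists>T \<mu>. 0 < \<mu> \<and> \<mu> \<le> T \<and> \<not> stabilizer T \<mu> K"
proof -
  define a b where "a = - K $ 1 $ 1" and "b = - K $ 1 $ 2"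
  have a: "0 < a"
    using assms by (simp add: a_def)
  \<comment> \<open>While braking, the position stays above L - 1/2 and the speed below 2 (both
    bounds inclusive). This \<open>L\<close> therefore keeps a p + b v \<ge> 3, so that the signal
    never exceeds 1.\<close>
  define L where "L = 1 / 2 + (3 + 2 * \<bar>b\<bar>) / a"
  define D where "D = a * (L + 1) + 2 * \<bar>b\<bar>"
  \<comment> \<open>Braking ends at time 1 in position L - 1/2; reaching -2 L at velocity -2 takes
    another 3/2 L - 1/4.\<close>
  define P where "P = 3 / 2 * L + 3 / 4"
  \<comment> \<open>The hinge \<open>w\<close> cancels the acceleration -3 after time 1, so one
    formula covers braking and coasting.\<close>
  define w p v where "w \<theta> = max 0 (\<theta> - 1)"
    and "p \<theta> = L + \<theta> - 3 / 2 * \<theta>\<^sup>2 + 3 / 2 * (w \<theta>)\<^sup>2"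
    and "v \<theta> = 1 - 3 * \<theta> + 3 * w \<theta>" for \<theta> :: real
  \<comment> \<open>Solved from -\<alpha> (a p + b v) = -3 during braking.\<close>
  define \<alpha> where "\<alpha> \<theta> = (if \<theta> \<le> 1 then 3 / (a * p \<theta> + b * v \<theta>) else 0)" for \<theta>
  define q :: "real \<Rightarrow> real^2" where "q \<theta> = vector [p \<theta>, v \<theta>]" for \<theta>
  define f where "f \<theta> = (dint_A + \<alpha> \<theta> *\<^sub>R (dint_B ** K)) *v q \<theta>" for \<theta>
  define x where "x = self_similar P (-2) q"
  define \<alpha>' where "\<alpha>' = self_similar P 1 \<alpha>"

  have L: "1 / 2 < L" "a * (L - 1 / 2) = 3 + 2 * \<bar>b\<bar>"
    using a by (auto simp: L_def field_simps intro!: add_pos_nonneg)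
  then have P: "0 < P" "1 < P"
    by (auto simp: P_def)
  have den: "3 \<le> a * p \<theta> + b * v \<theta>" "a * p \<theta> + b * v \<theta> \<le> D" if "0 \<le> \<theta>" "\<theta> \<le> 1" for \<theta>
  proof -
    have "p \<theta> = L + \<theta> - 3 / 2 * \<theta>\<^sup>2" "v \<theta> = 1 - 3 * \<theta>"
      using that by (auto simp: p_def v_def w_def)
    moreover have "\<theta>\<^sup>2 \<le> \<theta>" "0 \<le> \<theta>\<^sup>2"
      using that by (auto simp: power2_eq_square mult_left_le)
    ultimately have "L - 1 / 2 \<le> p \<theta>" "p \<theta> \<le> L + 1" "\<bar>v \<theta>\<bar> \<le> 2"
      using that by (simp_all only: abs_le_iff) linarith+
    then have "a * (L - 1 / 2) \<le> a * p \<theta>" "a * p \<theta> \<le> a * (L + 1)" "\<bar>b * v \<theta>\<bar> \<le> 2 * \<bar>b\<bar>"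
      using a mult_left_mono[of "\<bar>v \<theta>\<bar>" 2 "\<bar>b\<bar>"] by (auto simp: abs_mult)
    then show "3 \<le> a * p \<theta> + b * v \<theta>" "a * p \<theta> + b * v \<theta> \<le> D"
      using L(2) by (simp_all only: abs_le_iff D_def) linarith+
  qed
  have D: "3 \<le> D"
    using den[of 0] by linarith
  have \<alpha>01: "\<alpha> \<theta> \<in> {0..1}" if "0 \<le> \<theta>" for \<theta>
    using den(1)[OF that] by (cases "\<theta> \<le> 1") (simp_all add: \<alpha>_def)
  have \<alpha>_ge: "3 / D \<le> \<alpha> \<theta>" if "0 \<le> \<theta>" "\<theta> \<le> 1" for \<theta>
    using den[OF that] that by (simp add: \<alpha>_def frac_le)

  have f_eq: "f \<theta> = vector [v \<theta>, if \<theta> \<le> 1 then - 3 else 0]" if "0 \<le> \<theta>" for \<theta>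
  proof -
    define d where "d = a * p \<theta> + b * v \<theta>"
    have "K $ 1 $ 1 * p \<theta> + K $ 1 $ 2 * v \<theta> = - d"
      by (simp add: a_def b_def d_def)
    moreover have "\<alpha> \<theta> = (if \<theta> \<le> 1 then 3 / d else 0)" "\<theta> \<le> 1 \<Longrightarrow> 3 \<le> d"
      using den(1)[OF that] by (simp_all add: \<alpha>_def d_def)
    ultimately show ?thesis
      unfolding f_def closed_loop_field by (cases "\<theta> \<le> 1") (simp_all add: q_def)
  qed
  have q: "(f has_integral (q \<theta> - q 0)) {0..\<theta>}" if "0 \<le> \<theta>" for \<theta>
  \<comment> \<open>The velocity has a corner at 1, so that time is exempted from
    differentiability.\<close>
  proof (rule fundamental_theorem_of_calculus_strong[where S = "{1}"])
    show "continuous_on {0..\<theta>} q"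
      unfolding q_def p_def v_def w_def vector_2_eq_axis by (intro continuous_intros)
    fix s assume s: "s \<in> {0..\<theta>} - {1}"
    have w: "(w has_real_derivative (if s \<le> 1 then 0 else 1)) (at s)"
    proof (cases "s < 1")
      case True
      have "((\<lambda>_. 0) has_real_derivative 0) (at s)"
        by simp
      then have "(w has_real_derivative 0) (at s)"
        by (rule has_field_derivative_transform_within_open[of _ _ _ "{..<1}"])
          (use True in \<open>auto simp: w_def\<close>)
      then show ?thesis
        using True by simp
    next
      case False
      have "((\<lambda>s. s - 1) has_real_derivative 1) (at s)"
        by (auto intro!: derivative_eq_intros)
      then have "(w has_real_derivative 1) (at s)"
        by (rule has_field_derivative_transform_within_open[of _ _ _ "{1<..}"])
          (use False s in \<open>auto simp: w_def\<close>)
      then show ?thesis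
        using False s by simp
    qed
    have "(p has_real_derivative v s) (at s)"
      unfolding p_def
      by (rule derivative_eq_intros w refl | simp)+ (simp add: v_def w_def)
    moreover have "(v has_real_derivative (if s \<le> 1 then - 3 else 0)) (at s)"
      unfolding v_def by (rule derivative_eq_intros w refl | simp)+
    ultimately have "(q has_vector_derivative
        (v s *\<^sub>R axis 1 1 + (if s \<le> 1 then - 3 else 0) *\<^sub>R axis 2 1)) (at s)"
      unfolding q_def vector_2_eq_axis
      by (auto intro!: derivative_eq_intros)
    then show "(q has_vector_derivative f s) (at s)"
      using s by (simp add: f_eq vector_2_eq_axis)
  qed (use that in auto)
  have q_per: "q P = (-2) *\<^sub>R q 0"
  proof -
    have w: "w P = P - 1"
      using P by (simp add: w_def)
    have "p P = - 2 * L" "v P = - 2"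
      unfolding p_def v_def w by (simp_all add: P_def power2_eq_square field_simps)
    then show ?thesis
      by (simp add: q_def vec_eq_iff forall_2 p_def v_def w_def)
  qed
  have \<alpha>'01: "\<alpha>' t \<in> {0..1}" if t: "0 \<le> t" for t
  proof -
    obtain n where n: "P * real n \<le> t" "t < P * real n + P"
      using self_similar_cases[OF P(1) t] .
    have "\<alpha>' t = \<alpha> (t - P * real n)"
      unfolding \<alpha>'_def self_similar_eq[OF P(1) n] by simp
    moreover have "0 \<le> t - P * real n"
      using n(1) by simp
    ultimately show ?thesis
      using \<alpha>01 by metis
  qed
  have sol: "is_closed_loop_solution K \<alpha>' 0 (x 0) x"
  proof (rule is_closed_loop_solutionI)
    fix t :: real assume t: "0 \<le> t"
    have "(self_similar P (-2) f has_integral (x t - x 0)) {0..t}"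
      unfolding x_def by (intro has_integral_self_similar P q_per q t)
    \<comment> \<open>Linearity at work: the factor (-2)^n passes through the closed-loop matrix,
      while the signal repeats unscaled.\<close>
    moreover have "self_similar P (-2) f = (\<lambda>s. (dint_A + \<alpha>' s *\<^sub>R (dint_B ** K)) *v x s)"
      by (simp add: fun_eq_iff self_similar_def f_def x_def \<alpha>'_def
          matrix_vector_mult_scaleR)
    ultimately show "((\<lambda>s. (dint_A + \<alpha>' s *\<^sub>R (dint_B ** K)) *v x s) has_integral (x t - x 0)) {0..t}"
      by simp
  qed (rule \<alpha>'01)

  \<comment> \<open>Measurability and persistent excitation of the periodic signal\<close>
  have "\<alpha> \<in> borel_measurable borel"
    unfolding \<alpha>_def p_def v_def w_def by measurable
  moreover have "(\<lambda>t. t - P * of_int \<lfloor>t / P\<rfloor>) \<in> borel_measurable borel"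
    by measurable
  ultimately have "(\<lambda>t. \<alpha> (t - P * of_int \<lfloor>t / P\<rfloor>)) \<in> borel_measurable borel"
    by (rule measurable_compose[rotated])
  then have "\<alpha>' \<in> borel_measurable borel"
    by (simp add: \<alpha>'_def self_similar_def[abs_def])
  then have meas: "\<alpha>' \<in> borel_measurable (lebesgue_on S)" for S
    by (intro measurable_restrict_space1 measurable_completion) simp
  have int: "\<alpha>' integrable_on {s..t}" if "0 \<le> s" for s t
    by (rule measurable_bounded_by_integrable_imp_integrable[OF meas, where g = "\<lambda>_. 1"])
      (use \<alpha>'01 that in auto)
  \<comment> \<open>The next period starts at some s \<le> t + P. Since P > 1, its whole braking
    phase, of length 1 and with signal at least 3/D, lies in the window of length 2 P.\<close>
  have pe: "3 / D \<le> integral {t..t + 2 * P} \<alpha>'" if t: "0 \<le> t" for t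
  proof -
    obtain n where n: "P * real n \<le> t" "t < P * real n + P"
      using self_similar_cases[OF P(1) t] .
    define s where "s = P * real (Suc n)"
    have "P * real n = s - P"
      by (simp add: s_def distrib_left)
    then have s: "0 \<le> s" "t \<le> s" "s + 1 \<le> t + 2 * P"
      using n P t by simp_all
    have "3 / D \<le> \<alpha>' r" if "r \<in> {s..s + 1}" for r
    proof -
      have "P * real (Suc n) \<le> r" "r < P * real (Suc n) + P"
        using that P unfolding s_def by auto
      then have "\<alpha>' r = \<alpha> (r - s)"
        unfolding \<alpha>'_def s_def by (subst self_similar_eq[OF P(1), of "Suc n"]) simp_all
      then show ?thesis
        using \<alpha>_ge[of "r - s"] that by simp
    qed
    then have "integral {s..s + 1} (\<lambda>_. 3 / D) \<le> integral {s..s + 1} \<alpha>'"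
      using s by (intro integral_le int) auto
    also have "\<dots> \<le> integral {t..t + 2 * P} \<alpha>'"
      using s t \<alpha>'01 by (intro integral_subset_le int) auto
    finally show ?thesis
      by simp
  qed
  have "\<alpha>' \<in> pe_signals (2 * P) (3 / D)"
    using meas \<alpha>'01 pe by (simp add: pe_signals_def)
  \<comment> \<open>At the times P n the state is (-2)^n times the initial one, whose velocity
    component is 1.\<close>
  moreover have "\<exists>t\<ge>N. 1 \<le> norm (x t)" for N
  proof -
    obtain n where n: "N / P \<le> real n"
      using real_arch_simple by blast
    have "x (P * real n) = (-2) ^ n *\<^sub>R q 0"
      unfolding x_def using self_similar_eq[OF P(1), of n "P * real n"] P by simp
    moreover have "1 \<le> norm (q 0)"
      using component_le_norm_cart[of "q 0" 2] by (simp add: q_def v_def w_def)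
    moreover have "1 \<le> (2::real) ^ n"
      by simp
    ultimately have "1 \<le> norm (x (P * real n))"
      using mult_mono[of 1 "2 ^ n" 1 "norm (q 0)"] by (simp add: power_abs)
    then show ?thesis
      using n P by (intro exI[of _ "P * real n"]) (simp add: field_simps)
  qed
  ultimately have "\<not> stabilizer (2 * P) (3 / D) K"
    using sol by (intro not_stabilizerI[where r = 1]) auto
  moreover have "0 < 3 / D" "3 / D \<le> 2 * P"
  proof -
    show "0 < 3 / D"
      using D by simp
    have "3 / D \<le> 1"
      using D by simp
    then show "3 / D \<le> 2 * P"
      using P by linarith
  qed
  ultimately show ?thesis
    by blast
qed

theorem proposition19:
  fixes K :: "real^2^1"
  shows "\<exists>T \<mu>. 0 < \<mu> \<and> \<mu> \<le> T \<and> \<not> stabilizer T \<mu> K"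
proof (cases "0 \<le> K $ 1 $ 1")
  case True
  then have "\<not> stabilizer 1 1 K"
    by (rule not_stabilizer_of_nonneg)
  then show ?thesis
    by (intro exI[of _ 1]) simp
next
  case False
  then show ?thesis
    by (intro not_stabilizer_of_neg) simp
qed

end
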